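(* Let $S$ be a finite nonempty set of points in the integer lattice $\mathbb{Z}\times\mathbb{Z}\subset\mathbb{E}^2$. Then for every finite coloring of the plane $\mathbb{E}^2$, there exist uncountably many monochromatic subsets of $\mathbb{E}^2$ that are homothetic to $S$.
   Context: $\mathbb{E}^2$ denotes the Euclidean plane, identified with $\mathbb{R}^2$. A finite coloring of $\mathbb{E}^2$ is a map $\chi:\mathbb{E}^2\to\{1,\ldots,k\}$ for some positive integer $k$; a subset of $\mathbb{E}^2$ is monochromatic if $\chi$ is constant on it. A set $A\subset\mathbb{E}^2$ is homothetic to a set $B\subset\mathbb{E}^2$ if $A$ can be mapped onto $B$ by a translation and a dilation (scaling by a positive real factor), i.e. $B=v+\lambda A$ for some $v\in\mathbb{R}^2$ and some real $\lambda>0$. *)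

theory Defs
  imports "HOL-Analysis.Analysis"
begin

text \<open>The Euclidean plane is the type \<open>real \<times> real\<close>, whose library norm is the Euclidean one;
  the integer lattice in it is \<open>\<int> \<times> \<int>\<close>.\<close>

definition finite_coloring :: "('a \<Rightarrow> nat) \<Rightarrow> bool" where
  "finite_coloring c \<longleftrightarrow> (\<exists>k>0. range c \<subseteq> {1..k})"

definition monochromatic :: "('a \<Rightarrow> nat) \<Rightarrow> 'a set \<Rightarrow> bool" where
  "monochromatic c A \<longleftrightarrow> c constant_on A"

definition homothetic :: "'a::real_vector set \<Rightarrow> 'a set \<Rightarrow> bool" where
  "homothetic A B \<longleftrightarrow> (\<exists>v. \<exists>l::real. l > 0 \<and> B = (\<lambda>x. v + l *\<^sub>R x) ` A)"

end

theory Submission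
  imports Defs
begin

text \<open>Gallai's theorem is proved by colour focusing, in a uniform version: for each finite \<open>S\<close> and
  each number of colours there is a finite set of homotheties \<open>(a, d)\<close>, one of which takes \<open>S\<close> to a
  monochromatic set whatever the colouring. Applied to all translates \<open>\<lambda>x. c (v + x)\<close> of a
  colouring \<open>c\<close>, it expresses every point \<open>v\<close> of the plane through a point of a monochromatic copy
  of \<open>S\<close> and finitely many data. Countably many copies would thus make the plane countable.\<close>

lemma bex_pairI: "(a, b) \<in> A \<Longrightarrow> P a b \<Longrightarrow> \<exists>(a, b)\<in>A. P a b"
  by blast

definition unavoidable :: "'a::real_vector set \<Rightarrow> nat \<Rightarrow> ('a \<times> real) set \<Rightarrow> bool" where
  "unavoidable S k D \<longleftrightarrow> finite D \<and> (\<forall>(a, d)\<in>D. d > 0) \<and>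
     (\<forall>c. range c \<subseteq> {..<k} \<longrightarrow> (\<exists>(a, d)\<in>D. \<exists>q. \<forall>s\<in>S. c (a + d *\<^sub>R s) = q))"

lemma unavoidable_finite: "unavoidable S k D \<Longrightarrow> finite D"
  unfolding unavoidable_def by (rule conjunct1)

lemma unavoidable_pos: "unavoidable S k D \<Longrightarrow> (a, d) \<in> D \<Longrightarrow> d > 0"
  unfolding unavoidable_def by blast

lemma unavoidableE:
  assumes "unavoidable S k D" "range c \<subseteq> {..<k}"
  obtains a d q where "(a, d) \<in> D" "\<forall>s\<in>S. c (a + d *\<^sub>R s) = q"
  using assms unfolding unavoidable_def by blast

text \<open>Colour \<open>x\<close> by its whole pattern, the map \<open>y\<close> ->
  \<open>c (x + y)\<close> on \<open>F\<close>. There are only finitely many patterns, so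
  unavoidability with that many colours yields a copy of \<open>S\<close> on which the pattern is
  constant.\<close>

lemma unavoidable_shifts:
  fixes S F :: "'a::real_vector set" and k :: nat
  assumes S: "\<And>k. \<exists>D. unavoidable S k D" and F: "finite F"
  obtains D where "finite D" "\<And>a d. (a, d) \<in> D \<Longrightarrow> d > 0"
    "\<And>c. range c \<subseteq> {..<k} \<Longrightarrow> \<exists>(a, d)\<in>D. \<forall>y\<in>F. \<exists>q. \<forall>s\<in>S. c (a + d *\<^sub>R s + y) = q"
proof -
  define P where "P = (F \<rightarrow>\<^sub>E {..<k})"
  have "finite P"
    unfolding P_def using F by (intro finite_PiE) auto
  then obtain h where h: "bij_betw h P {0..<card P}"
    using ex_bij_betw_finite_nat by blast
  obtain D where D: "unavoidable S (card P) D"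
    using S by blast
  have "\<exists>(a, d)\<in>D. \<forall>y\<in>F. \<exists>q. \<forall>s\<in>S. c (a + d *\<^sub>R s + y) = q"
    if c: "range c \<subseteq> {..<k}" for c
  proof -
    define p where "p x = (\<lambda>y\<in>F. c (x + y))" for x
    have p: "p x \<in> P" for x
      using c by (auto simp: p_def P_def)
    have "range (h \<circ> p) \<subseteq> {..<card P}"
      using p bij_betw_apply[OF h] by fastforce
    then obtain a d q where ad: "(a, d) \<in> D" and q: "\<forall>s\<in>S. (h \<circ> p) (a + d *\<^sub>R s) = q"
      using D unfolding unavoidable_def by blast
    have "\<exists>q. \<forall>s\<in>S. c (a + d *\<^sub>R s + y) = q" if y: "y \<in> F" for y
    proof (cases "S = {}")
      case False
      then obtain s0 where s0: "s0 \<in> S" by blast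
      have "c (a + d *\<^sub>R s + y) = c (a + d *\<^sub>R s0 + y)" if "s \<in> S" for s
      proof -
        have "h (p (a + d *\<^sub>R s)) = h (p (a + d *\<^sub>R s0))"
          using q s0 that by simp
        then have "p (a + d *\<^sub>R s) = p (a + d *\<^sub>R s0)"
          using h p by (meson bij_betw_imp_inj_on inj_onD)
        then have "p (a + d *\<^sub>R s) y = p (a + d *\<^sub>R s0) y" by simp
        then show ?thesis using y by (simp add: p_def)
      qed
      then show ?thesis by blast
    qed auto
    with ad show ?thesis by blast
  qed
  with D show ?thesis
    by (intro that[of D]) (auto simp: unavoidable_def)
qed

text \<open>Each colour in \<open>C\<close> is the colour of a monochromatic copy of \<open>S\<close> whose extension to
  \<open>insert t S\<close> has \<open>f\<close> as its additional point.\<close>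

definition focused ::
  "'a::real_vector set \<Rightarrow> 'a \<Rightarrow> ('a \<times> real) set \<Rightarrow> ('a \<Rightarrow> nat) \<Rightarrow> 'a \<Rightarrow> nat set \<Rightarrow> bool" where
  "focused S t D c f C \<longleftrightarrow>
     (\<forall>q\<in>C. \<exists>(a, d)\<in>D. a + d *\<^sub>R t = f \<and> (\<forall>s\<in>S. c (a + d *\<^sub>R s) = q))"

text \<open>Every witnessing homothety sends \<open>t\<close> to \<open>f\<close>, so the copy of
  \<open>S\<close> with colour \<open>c f\<close> gains \<open>f\<close> and stays
  monochromatic.\<close>

lemma focused_insert_mono:
  assumes "focused S t D c f C" "c f \<in> C"
  shows "\<exists>(a, d)\<in>D. \<exists>q. \<forall>s\<in>insert t S. c (a + d *\<^sub>R s) = q"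
  using assms unfolding focused_def by fastforce

text \<open>Induction on the number \<open>r\<close> of focused colours: the configuration for
  \<open>r\<close> is viewed from a copy of \<open>S\<close> whose points all see the same colours
  on it, which adds one colour. \<open>D\<close> and \<open>E\<close> are fixed before
  \<open>c\<close>, so only finitely many points need to be controlled.\<close>

lemma color_focusing:
  fixes S :: "'a::real_vector set"
  assumes S: "\<And>k. \<exists>D. unavoidable S k D" and fin: "finite S" and ne: "S \<noteq> {}"
  shows "\<exists>D E. finite D \<and> finite E \<and> (\<forall>(a, d)\<in>D. d > 0) \<and>
    (\<forall>c. range c \<subseteq> {..<k} \<longrightarrow>
      (\<exists>(a, d)\<in>D. \<exists>q. \<forall>s\<in>insert t S. c (a + d *\<^sub>R s) = q) \<or>
      (\<exists>f\<in>E. \<exists>C\<subseteq>{..<k}. card C = r \<and> focused S t D c f C))"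
proof (induction r)
  case 0
  \<comment> \<open>With no colours asked for, any point serves as focus; \<open>0\<close> is an
    arbitrary choice.\<close>
  have "focused S t {} c 0 {}" for c
    by (simp add: focused_def)
  then show ?case
    by (intro exI[of _ "{}"] exI[of _ "{0}"]) auto
next
  case (Suc r)
  then obtain D E where D: "finite D" and E: "finite E" and pos: "\<forall>(a, d)\<in>D. d > 0"
    and IH: "\<forall>c. range c \<subseteq> {..<k} \<longrightarrow>
      (\<exists>(a, d)\<in>D. \<exists>q. \<forall>s\<in>insert t S. c (a + d *\<^sub>R s) = q) \<or>
      (\<exists>f\<in>E. \<exists>C\<subseteq>{..<k}. card C = r \<and> focused S t D c f C)"
    by (elim exE conjE) (rule that)
  \<comment> \<open>All points of the copies of \<open>S\<close> and all candidate foci from stage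
    \<open>r\<close>.\<close>
  define F where "F = (\<lambda>((a, d), s). a + d *\<^sub>R s) ` (D \<times> S) \<union> E"
  have "finite F"
    using D E fin by (simp add: F_def)
  then obtain D1 where D1: "finite D1" and pos1: "\<And>a d. (a, d) \<in> D1 \<Longrightarrow> d > 0"
    and D1F: "\<And>c. range c \<subseteq> {..<k} \<Longrightarrow> \<exists>(a, d)\<in>D1. \<forall>y\<in>F. \<exists>q. \<forall>s\<in>S. c (a + d *\<^sub>R s + y) = q"
    by (rule unavoidable_shifts[OF S, where k = k]) (rule that)
  \<comment> \<open>\<open>X\<close> carries the old colours, \<open>Y\<close> the new one, and
    \<open>Z\<close> moves a copy of \<open>insert t S\<close> found in the shifted colouring back
    to the original one.\<close>
  define X where "X = (\<lambda>((a, d), (b, e)). (a + b, d + e)) ` (D1 \<times> D)"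
  define Y where "Y = (\<lambda>((a, d), f). (a + f, d)) ` (D1 \<times> E)"
  define Z where "Z = (\<lambda>((a, d), (b, e), s). (a + d *\<^sub>R s + b, e)) ` (D1 \<times> D \<times> S)"
  define E1 where "E1 = (\<lambda>((a, d), f). a + d *\<^sub>R t + f) ` (D1 \<times> E)"
  let ?D = "X \<union> Y \<union> Z"
  have "\<forall>c. range c \<subseteq> {..<k} \<longrightarrow>
      (\<exists>(a, d)\<in>?D. \<exists>q. \<forall>s\<in>insert t S. c (a + d *\<^sub>R s) = q) \<or>
      (\<exists>f\<in>E1. \<exists>C\<subseteq>{..<k}. card C = Suc r \<and> focused S t ?D c f C)"
    (is "\<forall>c. _ \<longrightarrow> ?goal c")
  proof (intro allI impI)
    fix c :: "'a \<Rightarrow> nat"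
    assume c: "range c \<subseteq> {..<k}"
    obtain a d where ad: "(a, d) \<in> D1" and adF: "\<forall>y\<in>F. \<exists>q. \<forall>s\<in>S. c (a + d *\<^sub>R s + y) = q"
      using D1F[OF c] by blast
    obtain s0 where s0: "s0 \<in> S" using ne by blast
    \<comment> \<open>The colouring seen from one point of the copy. On \<open>F\<close> the choice
      of \<open>s0\<close> is immaterial; elsewhere it may matter.\<close>
    define c' where "c' y = c (a + d *\<^sub>R s0 + y)" for y
    have c'_eq: "c (a + d *\<^sub>R s + y) = c' y" if "s \<in> S" "y \<in> F" for s y
      using adF that s0 unfolding c'_def by metis
    have rc': "range c' \<subseteq> {..<k}"
      using c by (auto simp: c'_def)
    show "?goal c"
    proof (cases "\<exists>(b, e)\<in>D. \<exists>q. \<forall>s\<in>insert t S. c' (b + e *\<^sub>R s) = q")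
      case True
      then obtain b e q where be: "(b, e) \<in> D" and q: "\<forall>s\<in>insert t S. c' (b + e *\<^sub>R s) = q"
        by blast
      have "(a + d *\<^sub>R s0 + b, e) \<in> ?D"
        unfolding Z_def using ad be s0
        by (intro UnI2 image_eqI[where x = "((a, d), (b, e), s0)"]) simp_all
      moreover have "\<forall>s\<in>insert t S. c (a + d *\<^sub>R s0 + b + e *\<^sub>R s) = q"
        using q by (simp add: c'_def add.assoc)
      ultimately show ?thesis by (intro disjI1 bex_pairI exI)
    next
      case False
      then obtain f C where f: "f \<in> E" and C: "C \<subseteq> {..<k}" "card C = r"
        and foc: "focused S t D c' f C"
        using IH[rule_format, OF rc'] by blast
      \<comment> \<open>Otherwise the focus would complete a copy of \<open>insert t S\<close> under
        \<open>c'\<close>, which this case excludes.\<close>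
      have new: "c' f \<notin> C"
        using False focused_insert_mono[OF foc] by blast
      have "\<exists>(b, e)\<in>?D. b + e *\<^sub>R t = a + d *\<^sub>R t + f \<and> (\<forall>s\<in>S. c (b + e *\<^sub>R s) = q)"
        if "q \<in> insert (c' f) C" for q
      proof (cases "q = c' f")
        case True
        \<comment> \<open>The outer copy translated by \<open>f\<close> has colour
          \<open>c' f\<close> throughout, because \<open>f\<close> lies in \<open>F\<close>.\<close>
        have "(a + f, d) \<in> ?D"
          unfolding Y_def using ad f
          by (intro UnI1[OF UnI2] image_eqI[where x = "((a, d), f)"]) simp_all
        moreover have "\<forall>s\<in>S. c (a + f + d *\<^sub>R s) = q"
          using c'_eq[of _ f] f True by (simp add: F_def algebra_simps)
        moreover have "a + f + d *\<^sub>R t = a + d *\<^sub>R t + f"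
          by simp
        ultimately show ?thesis by (intro bex_pairI conjI)
      next
        case False
        with that have "q \<in> C" by simp
        with foc have "\<exists>(b, e)\<in>D. b + e *\<^sub>R t = f \<and> (\<forall>s\<in>S. c' (b + e *\<^sub>R s) = q)"
          unfolding focused_def by (rule bspec)
        then obtain b e where be: "(b, e) \<in> D" and bf: "b + e *\<^sub>R t = f"
          and q: "\<forall>s\<in>S. c' (b + e *\<^sub>R s) = q"
          by (elim bexE case_prodE conjE) simp
        \<comment> \<open>The sum of the homotheties uses the same \<open>s\<close> twice: (a + d s)
          + (b + e s) has the colour that \<open>c'\<close> gives to b + e s, and \<open>t\<close>
          goes to the new focus.\<close>
        have "(a + b, d + e) \<in> ?D"
          unfolding X_def using ad be
          by (intro UnI1 image_eqI[where x = "((a, d), (b, e))"]) simp_all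
        moreover have "\<forall>s\<in>S. c (a + b + (d + e) *\<^sub>R s) = q"
        proof
          fix s assume s: "s \<in> S"
          have "b + e *\<^sub>R s \<in> F"
            unfolding F_def using be s
            by (intro UnI1 image_eqI[where x = "((b, e), s)"]) simp_all
          then show "c (a + b + (d + e) *\<^sub>R s) = q"
            using c'_eq[OF s, of "b + e *\<^sub>R s"] q s by (simp add: algebra_simps)
        qed
        moreover have "a + b + (d + e) *\<^sub>R t = a + d *\<^sub>R t + f"
          using bf by (auto simp: algebra_simps)
        ultimately show ?thesis by (intro bex_pairI conjI)
      qed
      then have "focused S t ?D c (a + d *\<^sub>R t + f) (insert (c' f) C)"
        unfolding focused_def by (intro ballI)
      moreover have "a + d *\<^sub>R t + f \<in> E1"
        unfolding E1_def using ad f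
        by (intro image_eqI[where x = "((a, d), f)"]) simp_all
      moreover have "insert (c' f) C \<subseteq> {..<k}"
        using rc' C by auto
      moreover have "card (insert (c' f) C) = Suc r"
        using C new by (simp add: finite_subset)
      ultimately show ?thesis by (intro disjI2 bexI exI conjI)
    qed
  qed
  moreover have "finite ?D" "finite E1"
    using D E D1 fin by (simp_all add: X_def Y_def Z_def E1_def)
  moreover have "\<forall>(a, d)\<in>?D. d > 0"
    using pos pos1 by (auto simp: X_def Y_def Z_def intro: add_pos_pos)
  ultimately show ?case by (intro exI[of _ ?D] exI[of _ E1] conjI)
qed

text \<open>Induction on \<open>S\<close>, with \<open>k\<close> arbitrary because colouring by
  patterns calls for the induction hypothesis with other numbers of colours.\<close>

theorem gallai:
  fixes S :: "'a::real_vector set"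
  assumes "finite S" "S \<noteq> {}"
  shows "\<exists>D. unavoidable S k D"
  using assms
proof (induction S arbitrary: k rule: finite_ne_induct)
  case (singleton s)
  have "unavoidable {s} k {(0, 1)}"
    by (auto simp: unavoidable_def)
  then show ?case by blast
next
  case (insert t S)
  obtain D E where D: "finite D" "\<forall>(a, d)\<in>D. d > 0"
    and DE: "\<And>c. range c \<subseteq> {..<k} \<Longrightarrow>
      (\<exists>(a, d)\<in>D. \<exists>q. \<forall>s\<in>insert t S. c (a + d *\<^sub>R s) = q) \<or>
      (\<exists>f\<in>E. \<exists>C\<subseteq>{..<k}. card C = k \<and> focused S t D c f C)"
    using color_focusing[OF insert.IH insert.hyps(1,2), of k t k] by blast
  have "\<exists>(a, d)\<in>D. \<exists>q. \<forall>s\<in>insert t S. c (a + d *\<^sub>R s) = q" if c: "range c \<subseteq> {..<k}" for c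
    using DE[OF c]
  proof
    assume "\<exists>f\<in>E. \<exists>C\<subseteq>{..<k}. card C = k \<and> focused S t D c f C"
    then obtain f C where C: "C \<subseteq> {..<k}" "card C = k" and foc: "focused S t D c f C"
      by blast
    \<comment> \<open>The \<open>k\<close> focused colours are all the colours, so the colour of the
      focus is among them.\<close>
    have "C = {..<k}"
      using C by (intro card_subset_eq) auto
    then have "c f \<in> C"
      using c by auto
    with foc show ?thesis by (rule focused_insert_mono)
  qed
  with D show ?case
    unfolding unavoidable_def by blast
qed

text \<open>\<open>homothetic\<close> maps its first argument onto the second, so the witness is the
  inverse homothety.\<close>

lemma homothetic_image:
  assumes "d > 0"
  shows "homothetic ((\<lambda>s. a + d *\<^sub>R s) ` S) S"
proof -
  have "S = (\<lambda>x. - (a /\<^sub>R d) + inverse d *\<^sub>R x) ` (\<lambda>s. a + d *\<^sub>R s) ` S"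
    using assms by (simp add: image_image scaleR_add_right)
  then show ?thesis
    unfolding homothetic_def using assms by (meson positive_imp_inverse_positive)
qed

text \<open>Homotheties are injective. Finiteness of the copies makes the union of countably many of
  them countable.\<close>

lemma homothetic_finite:
  assumes "homothetic A S" "finite S"
  shows "finite A"
proof -
  obtain v l where l: "l > 0" and S: "S = (\<lambda>x. v + l *\<^sub>R x) ` A"
    using assms(1) unfolding homothetic_def by blast
  have "inj_on (\<lambda>x. v + l *\<^sub>R x) A"
    using l by (auto simp: inj_on_def)
  with S assms(2) show ?thesis
    using finite_imageD by blast
qed

theorem theorem9:
  fixes S :: "(real \<times> real) set" and c :: "real \<times> real \<Rightarrow> nat"
  assumes "finite S" and "S \<noteq> {}" and "S \<subseteq> \<int> \<times> \<int>"
    and "finite_coloring c"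
  shows "uncountable {A. monochromatic c A \<and> homothetic A S}"
proof
  let ?M = "{A. monochromatic c A \<and> homothetic A S}"
  assume count: "countable ?M"
  obtain k where "range c \<subseteq> {1..k}"
    using assms(4) unfolding finite_coloring_def by blast
  \<comment> \<open>The colours from 1 to \<open>k\<close> lie in \<open>{..<Suc k}\<close>, hence
    \<open>Suc k\<close> colours below.\<close>
  then have k: "c x < Suc k" for x
    by (force simp: less_Suc_eq_le)
  obtain D where D: "unavoidable S (Suc k) D"
    using gallai assms(1,2) by blast
  \<comment> \<open>Solves x = v + a + d s for \<open>v\<close>, with \<open>x\<close> in a copy
    from \<open>?M\<close>. Countability of \<open>?M\<close> makes \<open>T\<close> countable, yet
    \<open>T\<close> will be the whole plane.\<close>
  define T where "T = (\<lambda>(x, (a, d), s). x - (a + d *\<^sub>R s)) ` (\<Union>?M \<times> D \<times> S)"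
  have "countable (\<Union>A\<in>?M. A)"
  proof (rule countable_UN[OF count])
    fix A assume "A \<in> ?M"
    then have "homothetic A S" by simp
    then show "countable A"
      using assms(1) homothetic_finite countable_finite by blast
  qed
  then have "countable (\<Union>?M)" by simp
  moreover have "countable D" "countable S"
    using D assms(1) by (simp_all add: unavoidable_finite countable_finite)
  ultimately have "countable T"
    unfolding T_def by (intro countable_image countable_SIGMA)
  moreover have "v \<in> T" for v
  proof -
    \<comment> \<open>The translate of \<open>c\<close> by \<open>v\<close> obeys the same bound, so
      the same \<open>D\<close> serves every \<open>v\<close>.\<close>
    have "range (\<lambda>x. c (v + x)) \<subseteq> {..<Suc k}"
      using k by blast
    from unavoidableE[OF D this] obtain a d q
      where ad: "(a, d) \<in> D" and q: "\<forall>s\<in>S. c (v + (a + d *\<^sub>R s)) = q"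
      by blast
    have "d > 0"
      using D ad by (rule unavoidable_pos)
    then have "homothetic ((\<lambda>s. v + a + d *\<^sub>R s) ` S) S"
      by (rule homothetic_image)
    moreover have "monochromatic c ((\<lambda>s. v + a + d *\<^sub>R s) ` S)"
      using q by (auto simp: monochromatic_def constant_on_def add.assoc)
    moreover obtain s where s: "s \<in> S" using assms(2) by blast
    ultimately have "v + a + d *\<^sub>R s \<in> \<Union>?M" by blast
    with ad s have "(\<lambda>(x, (a, d), s). x - (a + d *\<^sub>R s)) (v + a + d *\<^sub>R s, (a, d), s) \<in> T"
      unfolding T_def by (intro imageI) simp
    then show ?thesis by simp
  qed
  then have "T = UNIV" by blast
  moreover have "uncountable (UNIV :: (real \<times> real) set)"
    using uncountable_ball[of 1 "0 :: real \<times> real"] countable_subset[OF subset_UNIV]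
    by (meson zero_less_one)
  ultimately show False by simp
qed

end
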